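(* Let $q$ be an odd prime power. For $k\in\{1,3\}$, the linear set $L_{\psi_8^{(k)}}$ of $\mathrm{PG}(1,q^8)$ is not of LP-type.
   Context: $\psi_8(x)=\frac12\bigl(x^{q}+x^{q^{3}}-x^{q^{5}}+x^{q^{7}}\bigr)\in\mathbb{F}_{q^8}[x]$, regarded as an $\mathbb{F}_q$-linear map of $\mathbb{F}_{q^8}$, and $\psi_8^{(k)}$ is its $k$-fold composition with itself. For a $q$-polynomial $f$ (polynomial of the form $\sum_i c_ix^{q^i}$) over $\mathbb{F}_{q^n}$, $L_f=\{\langle (x,f(x))\rangle_{\mathbb{F}_{q^n}}: x\in\mathbb{F}_{q^n}^*\}\subseteq\mathrm{PG}(1,q^n)$. Two linear sets of $\mathrm{PG}(1,q^n)$ are $\mathrm{P\Gamma L}$-equivalent if some element of $\mathrm{P\Gamma L}(2,q^n)$ maps one onto the other. A linear set of $\mathrm{PG}(1,q^n)$, $n\ge 4$, is of LP-type if it is $\mathrm{P\Gamma L}$-equivalent to $L_f$ with $f(x)=\delta x^{q^s}+x^{q^{n-s}}$ for some $1\le s\le n-1$ with $\gcd(s,n)=1$ and some $\delta\in\mathbb{F}_{q^n}$ with $\mathrm{N}_{q^n/q}(\delta)\notin\{0,1\}$, where $\mathrm{N}_{q^n/q}(\delta)=\delta^{(q^n-1)/(q-1)}$. Here $n=8$. *)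

theory Defs
  imports "HOL-Analysis.Analysis" "HOL-Number_Theory.Prime_Powers"
begin

text \<open>
  Throughout, a finite field with \<open>q ^ n\<close> elements is a type \<open>'a :: {field, finite}\<close> with
  \<open>CARD('a) = q ^ n\<close>; any such type is the field, as it is unique up to isomorphism.
  Vectors of the underlying plane have type \<open>'a ^ 2\<close>.
\<close>

definition PG1 :: "('a::field ^ 2) set set" where
  "PG1 = {P. vec.subspace P \<and> vec.dim P = 1}"

definition field_automorphism :: "('a::field \<Rightarrow> 'a) \<Rightarrow> bool" where
  "field_automorphism \<sigma> \<longleftrightarrow>
     bij \<sigma> \<and> (\<forall>x y. \<sigma> (x + y) = \<sigma> x + \<sigma> y) \<and> (\<forall>x y. \<sigma> (x * y) = \<sigma> x * \<sigma> y)"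

definition GammaL2 :: "('a::field ^ 2 \<Rightarrow> 'a ^ 2) set" where
  "GammaL2 = {g. bij g \<and> (\<forall>v w. g (v + w) = g v + g w) \<and>
     (\<exists>\<sigma>. field_automorphism \<sigma> \<and> (\<forall>c v. g (c *s v) = \<sigma> c *s g v))}"

text \<open>
  Semilinear bijections that differ by a nonzero scalar induce the same map on points, so
  the set of induced maps is the quotient of \<open>GammaL2\<close> by the scalars.
\<close>

definition PGammaL2 :: "(('a::field ^ 2) set \<Rightarrow> ('a ^ 2) set) set" where
  "PGammaL2 = {restrict (\<lambda>P. g ` P) PG1 | g. g \<in> GammaL2}"

definition PGammaL_equivalent :: "('a::field ^ 2) set set \<Rightarrow> ('a ^ 2) set set \<Rightarrow> bool" where
  "PGammaL_equivalent L L' \<longleftrightarrow> (\<exists>\<phi>\<in>PGammaL2. \<phi> ` L = L')"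

text \<open>A \<open>q\<close>-polynomial enters only through the map it induces on the field.\<close>

definition linear_set_of :: "('a::field \<Rightarrow> 'a) \<Rightarrow> ('a ^ 2) set set" where
  "linear_set_of f = {vec.span {vector [x, f x]} | x. x \<noteq> 0}"

definition field_norm :: "nat \<Rightarrow> nat \<Rightarrow> 'a::field \<Rightarrow> 'a" where
  "field_norm q n \<delta> = \<delta> ^ ((q ^ n - 1) div (q - 1))"

definition LP_type :: "nat \<Rightarrow> nat \<Rightarrow> ('a::field ^ 2) set set \<Rightarrow> bool" where
  "LP_type q n L \<longleftrightarrow>
     (\<exists>s \<delta>. 1 \<le> s \<and> s \<le> n - 1 \<and> coprime s n \<and> field_norm q n \<delta> \<notin> {0, 1} \<and>
        PGammaL_equivalent L (linear_set_of (\<lambda>x. \<delta> * x ^ (q ^ s) + x ^ (q ^ (n - s)))))"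

definition psi8 :: "nat \<Rightarrow> 'a::field \<Rightarrow> 'a" where
  "psi8 q x = 1 / 2 * (x ^ q + x ^ (q ^ 3) - x ^ (q ^ 5) + x ^ (q ^ 7))"

end

theory Submission
  imports Defs "HOL-Number_Theory.Residues" "Jordan_Normal_Form.Determinant"
begin

text \<open>
  Write \<open>t\<close> for the Frobenius map \<open>x \<mapsto> x^q\<close>. In the group algebra of the cyclic group of order 8
  generated by \<open>t\<close>, the square of \<open>\<psi> = (t + t^3 - t^5 + t^7) / 2\<close> is \<open>t^2\<close>, hence
  \<open>\<psi>^3 = (t + t^3 + t^5 - t^7) / 2\<close>. Both maps have the form \<open>f = f1 t + f3 t^3 + f5 t^5 + f7 t^7\<close>
  with nonzero coefficients in the prime field and \<open>f1 * f7 \<noteq> f3 * f5\<close>. No linear set of such an \<open>f\<close> is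
  of LP-type (\<open>not_LP_type_odd_qpoly\<close>), for the following reason.

  For any \<open>q\<close>-polynomial \<open>f\<close>, a point \<open>(X, Y)\<close> lies on \<open>L_f\<close> iff the \<open>q\<close>-polynomial \<open>Y x - X f(x)\<close> has
  a nonzero root, i.e. iff the determinant \<open>D_f(X, Y)\<close> of its Dickson matrix vanishes
  (\<open>det_dickson_eq_0_iff\<close>). This determinant takes values in the subfield of size \<open>q\<close>
  (\<open>det_dickson_power_q\<close>), so \<open>D_f^(q-1)\<close> is the indicator function of the complement of \<open>L_f\<close>. Let a
  semilinear map take \<open>L_f\<close> to \<open>L_h\<close>. As \<open>f\<close> commutes with field automorphisms, the map can be taken
  to be linear, with matrix \<open>A\<close> (\<open>PGammaL_equivalent_imp_moebius\<close>), and \<open>D_f^(q-1)\<close> and \<open>(D_h \<circ> A)^(q-1)\<close>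
  are the same function. Their degree is at most \<open>q^n - 1\<close>, so after putting \<open>X = 1\<close> they are the same
  polynomial in \<open>Y\<close>, and \<open>D_f\<close> is a constant multiple of \<open>D_h \<circ> A\<close>. Row \<open>i\<close> of the Dickson matrix is
  linear in the pair \<open>(X^(q^i), Y^(q^i))\<close>, and base \<open>q\<close> expansions are unique; so the relation remains true
  if these \<open>n\<close> conjugate pairs are replaced by \<open>n\<close> independent pairs
  (\<open>moebius_imp_pencils_proportional\<close>). So \<open>L_f\<close> and \<open>L_h\<close> have the same multilinear form, up to
  a constant and the action of \<open>A\<close> and its conjugates on the pairs.

  The two multilinear forms behave differently. Let \<open>h = \<delta> t^s + t^(8-s)\<close>. One pair makes the rows \<open>s\<close>
  and \<open>8 - s\<close> multiples of unit vectors, another one makes row \<open>0\<close> a multiple of row \<open>0\<close> of \<open>h\<close>; these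
  three rows lie in a space of dimension two, so the form of \<open>h\<close> vanishes, whatever the other five rows are
  (\<open>det_two_term_pencil_eq_0\<close>). Transported by \<open>A\<close>, the two pairs are still distinct points of
  the projective line, and for the form of \<open>f\<close> it is possible, in each position of two distinct points, to
  choose the other five rows so that it does not vanish (\<open>det_odd_pencil_neq_0\<close>).
\<close>

section \<open>Field automorphisms and powers of the Frobenius map\<close>

lemma field_automorphism_power:
  assumes "field_automorphism \<sigma>"
  shows "\<sigma> (x ^ m) = \<sigma> x ^ m"
proof (induction m)
  case 0
  have "\<sigma> 1 * \<sigma> 1 = \<sigma> 1 * 1" "\<sigma> 0 = 0" "inj \<sigma>"
    using assms unfolding field_automorphism_def bij_def by (metis mult_1_right, metis add_0_right add_left_cancel, blast)
  then show ?case by (metis injD mult_left_cancel power_0 zero_neq_one)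
qed (use assms in \<open>simp add: field_automorphism_def\<close>)

lemma field_automorphism_half:
  fixes \<sigma> :: "'a::field \<Rightarrow> 'a"
  assumes "field_automorphism \<sigma>"
  shows "\<sigma> (1 / 2) = 1 / 2"
proof (cases "(2::'a) = 0")
  case False
  have add: "\<sigma> (x + y) = \<sigma> x + \<sigma> y" and one: "\<sigma> 1 = 1" for x y
    using assms field_automorphism_power[OF assms, of _ 0] by (simp_all add: field_automorphism_def)
  have "\<sigma> (1 / 2) + \<sigma> (1 / 2) = \<sigma> (1 / 2 + 1 / 2)" by (rule add[symmetric])
  also have "1 / 2 + 1 / 2 = (1::'a)" using False by (simp add: field_simps)
  finally show ?thesis
    using False by (simp add: one field_simps)
next
  case True
  have "\<sigma> 0 = 0" using assms unfolding field_automorphism_def by (metis add_0_right add_left_cancel)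
  with True show ?thesis by simp
qed

lemma field_automorphism_uminus:
  assumes "field_automorphism \<sigma>"
  shows "\<sigma> (- x) = - \<sigma> x"
proof -
  have "\<sigma> 0 = 0" "\<sigma> (x + - x) = \<sigma> x + \<sigma> (- x)"
    using assms unfolding field_automorphism_def by (metis add_0_right add_left_cancel, blast)
  then show ?thesis by (simp add: minus_unique)
qed

lemma finite_field_power_card:
  fixes x :: "'a::{field,finite}"
  shows "x ^ CARD('a) = x"
proof (cases "x = 0")
  case False
  have "x * (\<Prod>y\<in>UNIV-{0}. x * y) = x * x ^ (CARD('a) - 1) * \<Prod>(UNIV-{0})"
    by (simp add: prod.distrib mult_ac)
  also have "x * x ^ (CARD('a) - 1) = x ^ CARD('a)"
    by (metis Suc_pred' finite_UNIV_card_ge_0 finite_class.finite_UNIV power_Suc)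
  also have "(\<Prod>y\<in>UNIV-{0}. x * y) = (\<Prod>y\<in>UNIV-{0}. y)"
    by (rule prod.reindex_bij_witness[of _ "\<lambda>y. y / x" "\<lambda>y. x * y"]) (use False in auto)
  finally show ?thesis
    by simp
qed (simp add: power_0_left)

locale frobenius =
  fixes q n :: nat and ty :: "'a::{field,finite} itself"
  assumes q: "primepow q" and card: "CARD('a) = q ^ n"
begin

lemma q_gt_1: "q > 1"
  using primepow_gt_Suc_0[OF q] by simp

lemma n_pos: "n > 0"
proof (rule ccontr)
  assume "\<not> n > 0"
  then have "CARD('a) = 1" using card by simp
  then obtain c :: 'a where "UNIV = {c}" by (rule card_1_singletonE)
  then have "(0::'a) = 1" by (metis UNIV_I singletonD)
  then show False by simp
qed

lemma prime_CHAR: "prime CHAR('a)"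
  by (rule prime_CHAR_semidom, rule finite_imp_CHAR_pos) simp

lemma q_power_CHAR: "\<exists>e. q = CHAR('a) ^ e"
proof -
  obtain p e where pe: "prime p" "q = p ^ e"
    using q unfolding primepow_def by blast
  have "CHAR('a) dvd (p ^ e) ^ n"
    using CHAR_dvd_CARD[where ?'a = 'a] by (simp add: card pe)
  then have "CHAR('a) dvd p"
    using prime_CHAR prime_dvd_power by blast
  then have "CHAR('a) = p"
    using pe prime_CHAR primes_dvd_imp_eq by blast
  with pe show ?thesis by blast
qed

text \<open>
  The power of the Frobenius map with an arbitrary integer exponent; on a field with \<open>q^n\<close>
  elements it depends only on the exponent modulo \<open>n\<close>.
\<close>

definition fr :: "int \<Rightarrow> 'a \<Rightarrow> 'a" where
  "fr i x = x ^ (q ^ nat (i mod int n))"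

lemma fr_add: "fr i (x + y) = fr i x + fr i y"
proof -
  obtain e where "q = CHAR('a) ^ e"
    using q_power_CHAR by blast
  then show ?thesis
    unfolding fr_def using freshmans_dream'[OF prime_CHAR]
    by (metis power_mult)
qed

lemma fr_0 [simp]: "fr i 0 = 0"
  using q_gt_1 by (simp add: fr_def power_0_left)

lemma fr_1 [simp]: "fr i 1 = 1"
  by (simp add: fr_def)

lemma fr_mult: "fr i (x * y) = fr i x * fr i y"
  by (simp add: fr_def power_mult_distrib)

lemma fr_uminus: "fr i (- x) = - fr i x"
  using fr_add[of i x "- x"] by (simp add: minus_unique)

lemma fr_diff: "fr i (x - y) = fr i x - fr i y"
  using fr_add[of i x "- y"] by (simp add: fr_uminus)

lemma fr_sum: "fr i (sum f A) = (\<Sum>k\<in>A. fr i (f k))"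
  by (induction A rule: infinite_finite_induct) (simp_all add: fr_add)

lemma fr_prod: "fr i (prod f A) = (\<Prod>k\<in>A. fr i (f k))"
  by (induction A rule: infinite_finite_induct) (simp_all add: fr_mult)

lemma fr_eq_0_iff [simp]: "fr i x = 0 \<longleftrightarrow> x = 0"
  using q_gt_1 by (simp add: fr_def)

lemma fr_cong: "i mod int n = j mod int n \<Longrightarrow> fr i x = fr j x"
  by (simp add: fr_def)

lemma power_q_multiple: "x ^ (q ^ (n * d)) = (x :: 'a)"
proof (induction d)
  case (Suc d)
  have "x ^ (q ^ (n * Suc d)) = (x ^ (q ^ n)) ^ (q ^ (n * d))"
    by (simp add: power_add power_mult)
  then show ?case
    using finite_field_power_card[of x] Suc by (simp add: card)
qed simp

lemma fr_of_nat: "fr (int k) x = x ^ (q ^ k)"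
proof -
  have "x ^ (q ^ k) = x ^ (q ^ (n * (k div n) + k mod n))"
    by simp
  also have "\<dots> = x ^ (q ^ (k mod n))"
    by (simp only: power_add power_mult[of x] power_q_multiple)
  also have "\<dots> = fr (int k) x"
    by (simp add: fr_def flip: of_nat_mod)
  finally show ?thesis by simp
qed

lemma fr_0_index [simp]: "fr 0 x = x"
  using fr_of_nat[of 0] by simp

lemma fr_fr: "fr i (fr j x) = fr (i + j) x"
proof -
  have *: "fr k y = fr (int (nat (k mod int n))) y" for k y
    using n_pos by (intro fr_cong) simp
  have "fr i (fr j x) = fr (int (nat (i mod int n))) (fr (int (nat (j mod int n))) x)"
    using * by metis
  also have "\<dots> = x ^ (q ^ (nat (j mod int n) + nat (i mod int n)))"
    by (simp only: fr_of_nat power_mult power_add)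
  also have "\<dots> = fr (int (nat (j mod int n) + nat (i mod int n))) x"
    by (simp only: fr_of_nat)
  also have "\<dots> = fr (i + j) x"
    using n_pos by (intro fr_cong) (simp add: mod_simps add.commute)
  finally show ?thesis .
qed

text \<open>
  Indices of Frobenius powers and of coefficients live in the integers modulo \<open>n\<close>. They are
  kept as integers, with periodic functions on them, so that sums can be reindexed by
  any shift.
\<close>

lemma sum_shift:
  fixes f :: "int \<Rightarrow> 'b::comm_monoid_add"
  assumes "\<And>i. f (i mod int n) = f i"
  shows "(\<Sum>j<n. f (int j + k)) = (\<Sum>j<n. f (int j))"
proof -
  have eq: "nat ((int (nat ((int j - k) mod int n)) + k) mod int n) = j" 
    "nat ((int (nat ((int j + k) mod int n)) - k) mod int n) = j" if "j < n" for j
    using n_pos that by (simp_all add: mod_simps)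
  show ?thesis
    by (rule sum.reindex_bij_witness[of _ "\<lambda>j. nat ((int j - k) mod int n)"
          "\<lambda>j. nat ((int j + k) mod int n)"])
      (use eq n_pos in \<open>auto simp: assms nat_less_iff\<close>)
qed

lemma field_automorphism_fr: "field_automorphism (fr i)"
proof -
  have "inj (fr i)"
  proof (rule injI)
    fix x y assume "fr i x = fr i y"
    then have "fr i (x - y) = 0" by (simp only: fr_diff) simp
    then show "x = y" by simp
  qed
  then have "bij (fr i)"
    by (simp add: bij_def finite_UNIV_inj_surj)
  then show ?thesis
    by (simp add: field_automorphism_def fr_add fr_mult)
qed

lemma fr_half: "fr i (1 / 2) = 1 / 2"
  by (rule field_automorphism_half[OF field_automorphism_fr])

end

section \<open>Dickson matrices\<close>

context frobenius
begin

definition qpoly :: "(int \<Rightarrow> 'a) \<Rightarrow> 'a \<Rightarrow> 'a" where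
  "qpoly a x = (\<Sum>j<n. a (int j) * fr (int j) x)"

definition periodic :: "(int \<Rightarrow> 'a) \<Rightarrow> bool" where
  "periodic a \<longleftrightarrow> (\<forall>i. a (i mod int n) = a i)"

text \<open>
  The matrix of the map \<open>qpoly a\<close> acting on the vectors \<open>(x, x^q, x^(q^2), \<dots>)\<close>.
\<close>

definition dickson :: "(int \<Rightarrow> 'a) \<Rightarrow> 'a mat" where
  "dickson a = mat n n (\<lambda>(i, j). fr (int i) (a (int j - int i)))"

lemma periodicD: "periodic a \<Longrightarrow> i mod int n = j mod int n \<Longrightarrow> a i = a j"
  unfolding periodic_def by metis

lemma qpoly_shift:
  assumes "periodic a"
  shows "(\<Sum>j<n. a (int j + k) * fr (int j + k) x) = qpoly a x"
  unfolding qpoly_def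
  by (rule sum_shift[where f = "\<lambda>j. a j * fr j x"])
     (use assms in \<open>auto simp: periodic_def intro!: arg_cong2[of _ _ _ _ "(*)"] fr_cong\<close>)

lemma mult_mat_vec_0_iff:
  assumes "v \<in> carrier_vec n"
  shows "mat n n f *\<^sub>v v = 0\<^sub>v n \<longleftrightarrow> (\<forall>i<n. (\<Sum>j<n. f (i, j) * vec_index v j) = 0)"
  using assms by (auto simp: vec_eq_iff scalar_prod_def lessThan_atLeast0)

text \<open>
  A root \<open>x\<close> of the \<open>q\<close>-polynomial gives the kernel vector of its conjugates. Conversely the
  kernel of the Dickson matrix is stable under scaling and under the semilinear map that shifts
  a vector cyclically and raises its entries to the power \<open>q\<close>. Summing the orbit of \<open>c v\<close>
  under this map, for a kernel vector \<open>v\<close>, gives a fixed vector, that is the conjugates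
  of a root; it is nonzero for a suitable \<open>c\<close>, as it depends on \<open>c\<close> by a nonzero polynomial of
  degree less than the size of the field.
\<close>

lemma det_dickson_eq_0_iff:
  assumes a: "periodic a"
  shows "Determinant.det (dickson a) = 0 \<longleftrightarrow> (\<exists>x. x \<noteq> 0 \<and> qpoly a x = 0)"
proof
  assume "\<exists>x. x \<noteq> 0 \<and> qpoly a x = 0"
  then obtain x where x: "x \<noteq> 0" "qpoly a x = 0" by blast
  define v where "v = vec n (\<lambda>j. fr (int j) x)"
  have v: "v \<in> carrier_vec n" by (simp add: v_def)
  have "vec_index v 0 \<noteq> 0" using n_pos x by (simp add: v_def)
  then have "v \<noteq> 0\<^sub>v n" using n_pos by auto
  moreover have "dickson a *\<^sub>v v = 0\<^sub>v n"
    unfolding dickson_def mult_mat_vec_0_iff[OF v]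
  proof (intro allI impI)
    fix i assume "i < n"
    have "(\<Sum>j<n. (case (i, j) of (i, j) \<Rightarrow> fr (int i) (a (int j - int i))) * vec_index v j)
        = (\<Sum>j<n. fr (int i) (a (int j + - int i) * fr (int j + - int i) x))"
      by (rule sum.cong) (auto simp: v_def fr_mult fr_fr)
    also have "\<dots> = fr (int i) (qpoly a x)"
      by (simp only: fr_sum[symmetric] qpoly_shift[OF a])
    finally show "(\<Sum>j<n. (case (i, j) of (i, j) \<Rightarrow> fr (int i) (a (int j - int i))) * vec_index v j) = 0"
      using x by simp
  qed
  ultimately show "Determinant.det (dickson a) = 0"
    using v det_0_iff_vec_prod_zero[of "dickson a" n] by (auto simp: dickson_def)
next
  assume "Determinant.det (dickson a) = 0"
  then obtain v where v: "v \<in> carrier_vec n" "v \<noteq> 0\<^sub>v n" "dickson a *\<^sub>v v = 0\<^sub>v n"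
    using det_0_iff_vec_prod_zero[of "dickson a" n] by (auto simp: dickson_def)
  define w where "w i = vec_index v (nat (i mod int n))" for i
  have wn: "w (int j) = vec_index v j" if "j < n" for j
    using that by (simp add: w_def)
  have w: "periodic w"
    by (simp add: periodic_def w_def)
  have ker: "(\<Sum>j<n. fr i (a (int j - i)) * w (int j)) = 0" for i
  proof -
    have "nat (i mod int n) < n" using n_pos by (simp add: nat_less_iff)
    then have "(\<Sum>j<n. fr (int (nat (i mod int n))) (a (int j - int (nat (i mod int n)))) * vec_index v j) = 0"
      using v(3) unfolding dickson_def mult_mat_vec_0_iff[OF v(1)] by auto
    also have "(\<Sum>j<n. fr (int (nat (i mod int n))) (a (int j - int (nat (i mod int n)))) * vec_index v j)
      = (\<Sum>j<n. fr i (a (int j - i)) * w (int j))"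
      using n_pos
      by (intro sum.cong refl arg_cong2[of _ _ _ _ "(*)"])
         (auto simp: wn mod_simps intro!: periodicD[OF a] fr_cong arg_cong2[of _ _ _ _ fr, OF refl]
           simp: fr_cong[of "i mod int n" i])
    finally show ?thesis .
  qed
  (* the first entry of the sum over the orbit of c v *)
  define X where "X c = (\<Sum>k<n. fr (int k) (c * w (- int k)))" for c
  have root: "qpoly a (X c) = 0" for c
  proof -
    have "qpoly a (X c) = (\<Sum>j<n. \<Sum>k<n. a (int j) * fr (int j + int k) (c * w (- int k)))"
      by (simp add: qpoly_def X_def fr_sum fr_fr sum_distrib_left)
    also have "\<dots> = (\<Sum>j<n. \<Sum>k<n. a (int j) * fr (int k) (c * w (int j - int k)))"
    proof (rule sum.cong[OF refl])
      fix j
      have "(\<Sum>k<n. a (int j) * fr (int k + int j) (c * w (int j - (int k + int j))))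
         = (\<Sum>k<n. a (int j) * fr (int k) (c * w (int j - int k)))"
        by (rule sum_shift[where f = "\<lambda>k. a (int j) * fr k (c * w (int j - k))"])
           (auto intro!: arg_cong2[of _ _ _ _ "(*)"] fr_cong arg_cong2[of _ _ _ _ fr, OF refl]
             periodicD[OF w] simp: mod_simps fr_cong[of "_ mod int n"])
      then show "(\<Sum>k<n. a (int j) * fr (int j + int k) (c * w (- int k)))
         = (\<Sum>k<n. a (int j) * fr (int k) (c * w (int j - int k)))"
        by (simp add: add.commute)
    qed
    also have "\<dots> = (\<Sum>k<n. \<Sum>j<n. a (int j) * fr (int k) (c * w (int j - int k)))"
      by (rule sum.swap)
    also have "\<dots> = (\<Sum>k<n. fr (int k) c * fr (int k) (\<Sum>j<n. fr (- int k) (a (int j)) * w (int j - int k)))"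
      by (simp add: fr_sum fr_mult fr_fr sum_distrib_left mult_ac)
    also have "\<dots> = 0"
    proof (rule sum.neutral, rule ballI)
      fix k
      have "(\<Sum>j<n. fr (- int k) (a (int j)) * w (int j - int k))
          = (\<Sum>j<n. fr (- int k) (a (int j + - int k - - int k)) * w (int j + - int k))"
        by simp
      also have "\<dots> = (\<Sum>j<n. fr (- int k) (a (int j - - int k)) * w (int j))"
        by (rule sum_shift[where f = "\<lambda>j. fr (- int k) (a (j - - int k)) * w j"])
           (auto intro!: arg_cong2[of _ _ _ _ "(*)"] arg_cong2[of _ _ _ _ fr, OF refl]
             periodicD[OF w] periodicD[OF a] simp: mod_simps)
      also have "\<dots> = 0" by (rule ker)
      finally show "fr (int k) c * fr (int k) (\<Sum>j<n. fr (- int k) (a (int j)) * w (int j - int k)) = 0"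
        by simp
    qed
    finally show ?thesis .
  qed
  have "\<exists>c. X c \<noteq> 0"
  proof (rule ccontr)
    assume "\<not> (\<exists>c. X c \<noteq> 0)"
    then have X0: "X c = 0" for c by blast
    define p where "p = (\<Sum>k<n. Polynomial.monom (fr (int k) (w (- int k))) (q ^ k))"
    have "poly p c = X c" for c
      by (simp add: p_def poly_sum poly_monom X_def fr_mult fr_of_nat mult_ac)
    moreover have "degree p < CARD('a)"
      unfolding p_def card using q_gt_1 n_pos
      by (intro degree_sum_less) (auto intro!: le_less_trans[OF degree_monom_le])
    ultimately have "p = 0"
      using X0 by (intro poly_eqI_degree[of UNIV]) auto
    have "w (- int k) = 0" if "k < n" for k
    proof -
      have "0 = Polynomial.coeff p (q ^ k)" using \<open>p = 0\<close> by simp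
      also have "\<dots> = (\<Sum>l<n. if l = k then fr (int l) (w (- int l)) else 0)"
        unfolding p_def coeff_sum using q_gt_1 by (intro sum.cong) auto
      also have "\<dots> = fr (int k) (w (- int k))"
        using that by simp
      finally show ?thesis by simp
    qed
    then have "vec_index v j = 0" if "j < n" for j
    proof (cases "j = 0")
      case True
      then show ?thesis using \<open>\<And>k. k < n \<Longrightarrow> w (- int k) = 0\<close>[of 0] wn[of 0] that by simp
    next
      case False
      then have "w (- int (n - j)) = 0"
        using \<open>\<And>k. k < n \<Longrightarrow> w (- int k) = 0\<close>[of "n - j"] that by simp
      moreover have "w (- int (n - j)) = w (int j)"
      proof (rule periodicD[OF w])
        have "- int (n - j) = int j - int n"
          using that by (simp add: of_nat_diff)
        then show "(- int (n - j)) mod int n = int j mod int n"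
          by simp
      qed
      ultimately show ?thesis using wn[OF that] by argo
    qed
    then have "v = 0\<^sub>v n" using v(1) by auto
    then show False using v(2) by simp
  qed
  then show "\<exists>x. x \<noteq> 0 \<and> qpoly a x = 0"
    using root by blast
qed

text \<open>
  The Frobenius map permutes the rows and the columns of a Dickson matrix by the same cycle, so
  the determinant lies in the subfield of size \<open>q\<close>.
\<close>

lemma det_dickson_power_q:
  assumes a: "periodic a"
  shows "Determinant.det (dickson a) ^ q = Determinant.det (dickson a)"
proof -
  define p where "p i = (if i < n then (i + 1) mod n else i)" for i
  have bij: "bij_betw p {0..<n} {0..<n}"
  proof (rule bij_betw_byWitness[where f' = "\<lambda>i. (i + (n - 1)) mod n"])
    show "\<forall>i\<in>{0..<n}. (p i + (n - 1)) mod n = i"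
    proof
      fix i assume "i \<in> {0..<n}"
      then show "(p i + (n - 1)) mod n = i"
        by (cases "Suc i = n") (auto simp: p_def)
    qed
    show "\<forall>i\<in>{0..<n}. p ((i + (n - 1)) mod n) = i"
    proof
      fix i assume "i \<in> {0..<n}"
      then show "p ((i + (n - 1)) mod n) = i"
        using n_pos by (auto simp: p_def mod_simps)
    qed
  qed (use n_pos in \<open>auto simp: p_def\<close>)
  have p: "p permutes {0..<n}"
    by (rule bij_imp_permutes[OF bij]) (simp add: p_def)
  have M: "dickson a \<in> carrier_mat n n" by (simp add: dickson_def)
  define P where "P = mat n n (\<lambda>(i, j). dickson a $$ (p i, j))"
  define Q where "Q = mat n n (\<lambda>(i, j). transpose_mat P $$ (p i, j))"
  have "Determinant.det Q = signof p * (signof p * Determinant.det (dickson a))"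
    unfolding Q_def P_def
    by (subst det_permute_rows[OF _ p], simp, subst det_transpose[of _ n], simp,
        subst det_permute_rows[OF M p], rule refl)
  also have "\<dots> = Determinant.det (dickson a)"
    by (auto simp: sign_def)
  finally have Q: "Determinant.det Q = Determinant.det (dickson a)" .
  have "Determinant.det (dickson a) ^ q = fr 1 (Determinant.det (dickson a))"
    using fr_of_nat[of 1] by simp
  also have "\<dots> = Determinant.det (mat n n (\<lambda>(i, j). fr 1 (dickson a $$ (i, j))))"
  proof -
    have "fr 1 (signof s) = signof s" for s
      by (auto simp: sign_def fr_uminus)
    then show ?thesis
      unfolding det_def'[OF M] 
      by (subst det_def'[of _ n])
         (auto simp: fr_sum fr_mult fr_prod intro!: sum.cong prod.cong arg_cong2[of _ _ _ _ "(*)"]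
               dest: permutes_in_image)
  qed
  also have "mat n n (\<lambda>(i, j). fr 1 (dickson a $$ (i, j))) = transpose_mat Q"
  proof (rule eq_matI)
    fix i j assume "i < dim_row (transpose_mat Q)" "j < dim_col (transpose_mat Q)"
    then have ij: "i < n" "j < n" by (auto simp: Q_def)
    then have lt: "p i < n" "p j < n" using n_pos by (auto simp: p_def)
    have "fr 1 (fr (int i) (a (int j - int i))) = fr (int (p i)) (a (int (p j) - int (p i)))"
      unfolding fr_fr using ij
      by (auto simp: p_def of_nat_mod mod_simps add.commute intro!: arg_cong2[of _ _ _ _ fr, OF refl]
        periodicD[OF a] simp: fr_cong[of "_ mod int n"])
    then show "mat n n (\<lambda>(i, j). fr 1 (dickson a $$ (i, j))) $$ (i, j) = transpose_mat Q $$ (i, j)"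
      using ij lt by (simp add: Q_def P_def dickson_def)
  qed (auto simp: Q_def)
  also have "Determinant.det (transpose_mat Q) = Determinant.det Q"
    by (rule det_transpose[of _ n]) (simp add: Q_def)
  finally show ?thesis by (simp add: Q)
qed

end

section \<open>Polynomials with equal powers\<close>

lemma poly_bezout:
  fixes P Q :: "'a::field poly"
  assumes "Q \<noteq> 0"
  shows "\<exists>d u v. d \<noteq> 0 \<and> d = u * P + v * Q \<and> d dvd P \<and> d dvd Q"
proof -
  define I where "I = {d. d \<noteq> 0 \<and> (\<exists>u v. d = u * P + v * Q)}"
  have "Q = 0 * P + 1 * Q" by simp
  then have "Q \<in> I" unfolding I_def using assms by blast
  then obtain d where d: "d \<in> I" and least: "\<And>e. e \<in> I \<Longrightarrow> degree d \<le> degree e"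
    using ex_has_least_nat[of "\<lambda>d. d \<in> I" Q degree] by blast
  obtain u v where uv: "d = u * P + v * Q" "d \<noteq> 0"
    using d unfolding I_def by blast
  have dvd: "d dvd s * P + t * Q" for s t
  proof (rule ccontr)
    assume not: "\<not> d dvd s * P + t * Q"
    define r where "r = (s * P + t * Q) mod d"
    have "r \<noteq> 0" using not by (simp add: r_def mod_eq_0_iff_dvd)
    have "r = (s * P + t * Q) - d * ((s * P + t * Q) div d)"
      by (simp add: r_def minus_mult_div_eq_mod)
    also have "\<dots> = (s - u * ((s * P + t * Q) div d)) * P + (t - v * ((s * P + t * Q) div d)) * Q"
      by (subst (1) uv(1)) (simp add: algebra_simps)
    finally have "r \<in> I" unfolding I_def using \<open>r \<noteq> 0\<close> by blast
    then have "degree d \<le> degree r" by (rule least)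
    moreover have "degree r < degree d"
      unfolding r_def using \<open>r \<noteq> 0\<close> uv(2) by (intro degree_mod_less') (auto simp: r_def)
    ultimately show False by simp
  qed
  have "d dvd P" "d dvd Q"
    using dvd[of 1 0] dvd[of 0 1] by simp_all
  then show ?thesis using uv by blast
qed

text \<open>
  Cancelling a greatest common divisor leaves coprime polynomials with equal \<open>m\<close>-th powers;
  each of them divides a power of the other, so both are constant.
\<close>

lemma poly_power_eq_imp_proportional:
  fixes P Q :: "'a::field poly"
  assumes eq: "P ^ m = Q ^ m" and m: "m > 0"
  shows "\<exists>c. P = Polynomial.smult c Q"
proof (cases "Q = 0")
  case True
  then have "P = 0" using eq m by (simp add: zero_power)
  then show ?thesis using True by simp
next
  case False
  obtain d u v where d: "d \<noteq> 0" "d = u * P + v * Q" "d dvd P" "d dvd Q"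
    using poly_bezout[OF False] by blast
  obtain R S where RS: "P = d * R" "Q = d * S"
    using d(3,4) unfolding dvd_def by blast
  have "d * (u * R + v * S) = d * 1"
    using d(2) unfolding RS by (simp only: distrib_left mult.left_commute[of d] mult_1_right)
  then have uv: "u * R + v * S = 1"
    using d(1) mult_left_cancel[of d "u * R + v * S" 1] by blast
  have "d ^ m * R ^ m = d ^ m * S ^ m"
    using eq by (simp add: RS power_mult_distrib)
  then have RSm: "R ^ m = S ^ m"
    using d(1) by simp
  have unit: "A dvd 1" if "s * A + t * B = 1" "A ^ m = B ^ m" for A B s t :: "'a poly"
  proof -
    have tB: "t * B = 1 - s * A"
      using that(1) by (simp add: eq_diff_eq add.commute)
    have "A dvd 1 - (t * B) ^ k" for k
    proof (induction k)
      case (Suc k)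
      have "1 - (t * B) ^ Suc k = (1 - (t * B) ^ k) + (t * B) ^ k * (s * A)"
        unfolding tB by (simp add: algebra_simps)
      then show ?case
        using Suc by (simp only: dvd_add dvd_mult dvd_triv_right)
    qed simp
    then have "A dvd 1 - (t * B) ^ m" .
    moreover have "A dvd (t * B) ^ m"
      unfolding power_mult_distrib that(2)[symmetric] using m by (intro dvd_mult dvd_power) simp
    ultimately have "A dvd (1 - (t * B) ^ m) + (t * B) ^ m"
      by (rule dvd_add)
    then show ?thesis by simp
  qed
  have "R dvd 1" using unit[OF uv RSm] .
  moreover have "S dvd 1" using unit[of v S u R] uv RSm by (simp add: add.commute)
  ultimately obtain r s where rs: "R = [:r:]" "S = [:s:]" "r \<noteq> 0" "s \<noteq> 0"
    by (auto elim!: is_unit_polyE simp: dvd_field_iff)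
  then have "P = Polynomial.smult (r / s) Q"
    by (simp add: RS)
  then show ?thesis by blast
qed

section \<open>Determinants with rows depending on independent parameters\<close>

lemma sum_powers_less:
  fixes q :: nat
  assumes "q > 1" "S \<subseteq> {..<n}"
  shows "(\<Sum>i\<in>S. q ^ i) < q ^ n"
proof -
  have "(\<Sum>i\<in>S. q ^ i) \<le> (\<Sum>i<n. q ^ i)"
    using assms by (intro sum_mono2) auto
  also have "\<dots> < q ^ n"
  proof (induction n)
    case (Suc n)
    then have "(\<Sum>i<Suc n. q ^ i) < 2 * q ^ n" by simp
    also have "\<dots> \<le> q ^ Suc n" using assms by simp
    finally show ?case .
  qed simp
  finally show ?thesis .
qed

lemma inj_on_sum_powers:
  fixes q :: nat
  assumes "q > 1"
  shows "inj_on (\<lambda>S. \<Sum>i\<in>S. q ^ i) (Pow {..<n})"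
proof (induction n)
  case (Suc n)
  have top: "n \<in> S \<longleftrightarrow> (\<Sum>i\<in>S. q ^ i) \<ge> q ^ n" if "S \<subseteq> {..<Suc n}" for S
  proof
    assume "n \<in> S"
    then show "(\<Sum>i\<in>S. q ^ i) \<ge> q ^ n"
      using member_le_sum[of n S "\<lambda>i. q ^ i"] finite_subset[OF that] by simp
  next
    assume ge: "(\<Sum>i\<in>S. q ^ i) \<ge> q ^ n"
    show "n \<in> S"
    proof (rule ccontr)
      assume "n \<notin> S"
      then have "S \<subseteq> {..<n}" using that by (auto simp: less_Suc_eq)
      then show False using sum_powers_less[OF assms, of S n] ge by simp
    qed
  qed
  show ?case
  proof (rule inj_onI)
    fix S T assume S: "S \<in> Pow {..<Suc n}" and T: "T \<in> Pow {..<Suc n}"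
      and eq: "(\<Sum>i\<in>S. q ^ i) = (\<Sum>i\<in>T. q ^ i)"
    have fin: "finite S" "finite T" using S T finite_subset by auto
    have nn: "n \<in> S \<longleftrightarrow> n \<in> T" using top S T eq by simp
    have "(\<Sum>i\<in>S - {n}. q ^ i) = (\<Sum>i\<in>T - {n}. q ^ i)"
      using nn eq fin by (cases "n \<in> S") (simp_all add: sum_diff1_nat)
    moreover have "S - {n} \<in> Pow {..<n}" "T - {n} \<in> Pow {..<n}"
      using S T by (auto simp: less_Suc_eq)
    ultimately have "S - {n} = T - {n}" using Suc by (meson inj_onD)
    then show "S = T" using nn by blast
  qed
qed simp

text \<open>
  Row \<open>i\<close> of a pencil depends linearly on its own pair of parameters \<open>(x i, z i)\<close>. The
  determinant is thus a multilinear form in these pairs.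
\<close>

definition pencil :: "nat \<Rightarrow> (nat \<Rightarrow> nat \<Rightarrow> 'a) \<Rightarrow> (nat \<Rightarrow> nat \<Rightarrow> 'a) \<Rightarrow> (nat \<Rightarrow> 'a) \<Rightarrow> (nat \<Rightarrow> 'a)
    \<Rightarrow> 'a::comm_ring_1 mat" where
  "pencil n E K x z = mat n n (\<lambda>(i, j). x i * E i j + z i * K i j)"

definition pencil_coeff :: "nat \<Rightarrow> (nat \<Rightarrow> nat \<Rightarrow> 'a) \<Rightarrow> (nat \<Rightarrow> nat \<Rightarrow> 'a) \<Rightarrow> nat set \<Rightarrow> 'a::comm_ring_1"
  where "pencil_coeff n E K S = Determinant.det (mat n n (\<lambda>(i, j). if i \<in> S then K i j else E i j))"

lemma det_pencil:
  "Determinant.det (pencil n E K x z) =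
    (\<Sum>S\<in>Pow {..<n}. (\<Prod>i\<in>S. z i) * (\<Prod>i\<in>{..<n} - S. x i) * pencil_coeff n E K S)"
proof -
  let ?P = "{p. p permutes {0..<n}}"
  have "Determinant.det (pencil n E K x z) =
      (\<Sum>p\<in>?P. signof p * (\<Prod>i<n. z i * K i (p i) + x i * E i (p i)))"
    unfolding pencil_def
    by (subst det_def'[of _ n])
       (auto intro!: sum.cong arg_cong2[of _ _ _ _ "(*)"] prod.cong simp: lessThan_atLeast0
         dest: permutes_in_image)
  also have "\<dots> = (\<Sum>p\<in>?P. \<Sum>S\<in>Pow {..<n}. signof p *
      ((\<Prod>i\<in>S. z i * K i (p i)) * (\<Prod>i\<in>{..<n} - S. x i * E i (p i))))"
    by (simp add: prod_add sum_distrib_left)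
  also have "\<dots> = (\<Sum>S\<in>Pow {..<n}. \<Sum>p\<in>?P. signof p *
      ((\<Prod>i\<in>S. z i * K i (p i)) * (\<Prod>i\<in>{..<n} - S. x i * E i (p i))))"
    by (rule sum.swap)
  also have "\<dots> = (\<Sum>S\<in>Pow {..<n}. (\<Prod>i\<in>S. z i) * (\<Prod>i\<in>{..<n} - S. x i) * pencil_coeff n E K S)"
  proof (rule sum.cong[OF refl])
    fix S assume S: "S \<in> Pow {..<n}"
    have coeff: "pencil_coeff n E K S =
        (\<Sum>p\<in>?P. signof p * ((\<Prod>i\<in>S. K i (p i)) * (\<Prod>i\<in>{..<n} - S. E i (p i))))"
      unfolding pencil_coeff_def
    proof (subst det_def'[of _ n], simp, rule sum.cong[OF refl], rule arg_cong2[of _ _ _ _ "(*)", OF refl])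
      fix p assume p: "p \<in> ?P"
      have "(\<Prod>i = 0..<n. mat n n (\<lambda>(i, j). if i \<in> S then K i j else E i j) $$ (i, p i))
          = (\<Prod>i<n. if i \<in> S then K i (p i) else E i (p i))"
        using p by (auto intro!: prod.cong simp: lessThan_atLeast0 dest: permutes_in_image)
      also have "\<dots> = (\<Prod>i\<in>S. K i (p i)) * (\<Prod>i\<in>{..<n} - S. E i (p i))"
        using S by (subst prod.subset_diff[of S]) (auto intro!: arg_cong2[of _ _ _ _ "(*)"] prod.cong)
      finally show "(\<Prod>i = 0..<n. mat n n (\<lambda>(i, j). if i \<in> S then K i j else E i j) $$ (i, p i))
          = (\<Prod>i\<in>S. K i (p i)) * (\<Prod>i\<in>{..<n} - S. E i (p i))" .
    qed
    show "(\<Sum>p\<in>?P. signof p * ((\<Prod>i\<in>S. z i * K i (p i)) * (\<Prod>i\<in>{..<n} - S. x i * E i (p i)))) =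
        (\<Prod>i\<in>S. z i) * (\<Prod>i\<in>{..<n} - S. x i) * pencil_coeff n E K S"
      unfolding coeff sum_distrib_left by (intro sum.cong refl) (simp add: prod.distrib mult_ac)
  qed
  finally show ?thesis .
qed

context frobenius
begin

text \<open>
  The determinant along the curve \<open>x i = 1\<close>, \<open>z i = y^(q^i)\<close>, as a polynomial in \<open>y\<close>: a set \<open>S\<close>
  of rows contributes to the exponent with base \<open>q\<close> digits the indicator of \<open>S\<close>, so distinct sets
  contribute to distinct exponents.
\<close>

definition pencil_poly :: "(nat \<Rightarrow> nat \<Rightarrow> 'a) \<Rightarrow> (nat \<Rightarrow> nat \<Rightarrow> 'a) \<Rightarrow> 'a poly" where
  "pencil_poly E K = (\<Sum>S\<in>Pow {..<n}. Polynomial.monom (pencil_coeff n E K S) (\<Sum>i\<in>S. q ^ i))"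

lemma poly_pencil_poly:
  "poly (pencil_poly E K) y = Determinant.det (pencil n E K (\<lambda>_. 1) (\<lambda>i. fr (int i) y))"
  by (simp add: pencil_poly_def det_pencil poly_sum poly_monom fr_of_nat power_sum mult.commute)

lemma coeff_pencil_poly:
  assumes "S \<subseteq> {..<n}"
  shows "Polynomial.coeff (pencil_poly E K) (\<Sum>i\<in>S. q ^ i) = pencil_coeff n E K S"
proof -
  have "Polynomial.coeff (pencil_poly E K) (\<Sum>i\<in>S. q ^ i) =
     (\<Sum>T\<in>Pow {..<n}. if T = S then pencil_coeff n E K T else 0)"
    unfolding pencil_poly_def coeff_sum
    using inj_on_sum_powers[OF q_gt_1, of n] assms
    by (intro sum.cong) (auto dest: inj_onD)
  then show ?thesis using assms by simp
qed

text \<open>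
  This is the bound that makes the power \<open>q - 1\<close> of the determinant along the curve a reduced
  polynomial, determined by its values on the field.
\<close>

lemma degree_pencil_poly_power: "degree (pencil_poly E K ^ (q - 1)) < CARD('a)"
proof -
  have "degree (pencil_poly E K) \<le> (\<Sum>i<n. q ^ i)"
    unfolding pencil_poly_def
  proof (rule degree_sum_le)
    fix S assume "S \<in> Pow {..<n}"
    then have "(\<Sum>i\<in>S. q ^ i) \<le> (\<Sum>i<n. q ^ i)"
      by (intro sum_mono2) auto
    then show "degree (Polynomial.monom (pencil_coeff n E K S) (\<Sum>i\<in>S. q ^ i)) \<le> (\<Sum>i<n. q ^ i)"
      by (rule order.trans[OF degree_monom_le])
  qed simp
  then have "degree (pencil_poly E K ^ (q - 1)) \<le> (\<Sum>i<n. q ^ i) * (q - 1)"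
    by (rule order.trans[OF degree_power_le mult_le_mono1])
  also have "(\<Sum>i<n. q ^ i) * (q - 1) = q ^ n - 1"
  proof -
    obtain r where r: "q = Suc r" using q_gt_1 by (cases q) auto
    have "(\<Sum>i<m. Suc r ^ i) * r + 1 = Suc r ^ m" for m
      by (induction m) (simp_all add: algebra_simps)
    then show ?thesis unfolding r by (metis add_diff_cancel_right' diff_Suc_1)
  qed
  also have "\<dots> < CARD('a)"
    using q_gt_1 by (simp add: card)
  finally show ?thesis .
qed

text \<open>
  Equality of functions of the single variable \<open>y\<close> gives, in turn, equality of polynomials,
  proportionality of the polynomials without the exponent, proportionality of the multilinear
  coefficients by uniqueness of base \<open>q\<close> digits, and so proportionality for independent
  parameters of the rows.
\<close>

lemma pencils_proportional:
  assumes "\<And>y. Determinant.det (pencil n E K (\<lambda>_. 1) (\<lambda>i. fr (int i) y)) ^ (q - 1) =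
                Determinant.det (pencil n E' K' (\<lambda>_. 1) (\<lambda>i. fr (int i) y)) ^ (q - 1)"
  shows "\<exists>c. \<forall>x z. Determinant.det (pencil n E K x z) = c * Determinant.det (pencil n E' K' x z)"
proof -
  have "pencil_poly E K ^ (q - 1) = pencil_poly E' K' ^ (q - 1)"
    by (rule poly_eqI_degree[of UNIV])
       (use assms degree_pencil_poly_power in \<open>simp_all add: poly_power poly_pencil_poly\<close>)
  then obtain c where c: "pencil_poly E K = Polynomial.smult c (pencil_poly E' K')"
    using poly_power_eq_imp_proportional[of _ "q - 1"] q_gt_1 by auto
  have "pencil_coeff n E K S = c * pencil_coeff n E' K' S" if "S \<in> Pow {..<n}" for S
    using that coeff_pencil_poly[of S E K] coeff_pencil_poly[of S E' K'] c by simp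
  then have "Determinant.det (pencil n E K x z) = c * Determinant.det (pencil n E' K' x z)" for x z
    unfolding det_pencil sum_distrib_left by (intro sum.cong) (simp_all add: mult_ac)
  then show ?thesis by blast
qed

end

section \<open>Linear sets and their equivalence\<close>

lemma vec2_eq_iff: "v = w \<longleftrightarrow> vec_nth v 1 = vec_nth w 1 \<and> vec_nth v 2 = vec_nth w 2"
  for v w :: "'a ^ 2"
  by (simp add: Finite_Cartesian_Product.vec_eq_iff forall_2)

lemma span_in_linear_set_of_iff:
  fixes v :: "'a::field ^ 2"
  assumes "v \<noteq> 0"
  shows "vec.span {v} \<in> linear_set_of f \<longleftrightarrow>
     (\<exists>x. x \<noteq> 0 \<and> vec_nth v 2 * x = vec_nth v 1 * f x)"
proof
  assume "vec.span {v} \<in> linear_set_of f"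
  then obtain x where x: "x \<noteq> 0" "vec.span {v} = vec.span {vector [x, f x]}"
    unfolding linear_set_of_def by blast
  have "v \<in> vec.span {vector [x, f x]}"
    using vec.span_base[of v "{v}"] x(2) by simp
  then obtain c where "v = c *s vector [x, f x]"
    by (auto simp: vec.span_singleton)
  then show "\<exists>x. x \<noteq> 0 \<and> vec_nth v 2 * x = vec_nth v 1 * f x"
    using x(1) by (intro exI[of _ x]) (simp add: vector_2)
next
  assume "\<exists>x. x \<noteq> 0 \<and> vec_nth v 2 * x = vec_nth v 1 * f x"
  then obtain x where x: "x \<noteq> 0" "vec_nth v 2 * x = vec_nth v 1 * f x" by blast
  have v1: "vec_nth v 1 \<noteq> 0"
    using assms x by (auto simp: vec2_eq_iff)
  define c where "c = vec_nth v 1 / x"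
  have c: "c \<noteq> 0" using v1 x by (simp add: c_def)
  have v: "v = c *s vector [x, f x]"
    using x by (simp add: vec2_eq_iff vector_2 c_def field_simps)
  have "vec.span {v} = vec.span {vector [x, f x]}"
  proof (rule vec.span_eq[THEN iffD2], intro conjI)
    show "{v} \<subseteq> vec.span {vector [x, f x]}"
      using v by (auto simp: vec.span_singleton)
    have "vector [x, f x] = inverse c *s v"
      using c v by simp
    then show "{vector [x, f x]} \<subseteq> vec.span {v}"
      by (auto simp: vec.span_singleton)
  qed
  then show "vec.span {v} \<in> linear_set_of f"
    unfolding linear_set_of_def using x(1) by blast
qed

lemma linear_set_of_subset_PG1: "linear_set_of f \<subseteq> PG1"
proof
  fix P assume "P \<in> linear_set_of f"
  then obtain x where x: "x \<noteq> 0" "P = vec.span {vector [x, f x]}"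
    unfolding linear_set_of_def by blast
  have "(vector [x, f x] :: 'a ^ 2) \<noteq> 0"
    using x(1) by (simp add: vec2_eq_iff vector_2)
  then have "vec.dim P = 1"
    unfolding x(2) using vec.dim_eq_card_independent[of "{vector [x, f x]}"] by simp
  then show "P \<in> PG1" by (simp add: PG1_def x(2))
qed

lemma image_span_singleton_semilinear:
  fixes g :: "'a::field ^ 2 \<Rightarrow> 'a ^ 2"
  assumes "surj \<sigma>" "\<And>c v. g (c *s v) = \<sigma> c *s g v"
  shows "g ` vec.span {v} = vec.span {g v}"
proof -
  have "g ` vec.span {v} = range (\<lambda>c. \<sigma> c *s g v)"
    by (simp add: vec.span_singleton image_image assms(2))
  also have "\<dots> = (\<lambda>c. c *s g v) ` range \<sigma>"
    by (simp add: image_image)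
  finally show ?thesis using assms(1) by (simp add: vec.span_singleton)
qed

text \<open>
  The automorphism belonging to the semilinear map preserves the linear set of \<open>f\<close>, because \<open>f\<close>
  commutes with it. Only a linear map, with matrix entries \<open>a\<close>, \<open>b\<close>, \<open>c\<close>, \<open>d\<close>, remains.
\<close>

lemma PGammaL_equivalent_imp_moebius:
  fixes f h :: "'a::field \<Rightarrow> 'a"
  assumes equiv: "PGammaL_equivalent (linear_set_of f) (linear_set_of h)"
    and comm: "\<forall>\<sigma> x. field_automorphism \<sigma> \<longrightarrow> f (\<sigma> x) = \<sigma> (f x)"
  shows "\<exists>a b c d. a * d - b * c \<noteq> 0 \<and> (\<forall>X Y. (X, Y) \<noteq> (0, 0) \<longrightarrow>
     (\<exists>x. x \<noteq> 0 \<and> Y * x = X * f x) \<longleftrightarrow>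
     (\<exists>x. x \<noteq> 0 \<and> (c * X + d * Y) * x = (a * X + b * Y) * h x))"
proof -
  obtain g where g: "g \<in> GammaL2" and img: "restrict (\<lambda>P. g ` P) PG1 ` linear_set_of f = linear_set_of h"
    using equiv unfolding PGammaL_equivalent_def PGammaL2_def by blast
  obtain \<sigma> where \<sigma>: "field_automorphism \<sigma>" and g_scale: "\<And>c v. g (c *s v) = \<sigma> c *s g v"
    and bij: "bij g" and g_add: "\<And>v w. g (v + w) = g v + g w"
    using g unfolding GammaL2_def by blast
  have bij\<sigma>: "bij \<sigma>" and \<sigma>_mult: "\<And>x y. \<sigma> (x * y) = \<sigma> x * \<sigma> y"
    and \<sigma>_add: "\<And>x y. \<sigma> (x + y) = \<sigma> x + \<sigma> y"
    using \<sigma> unfolding field_automorphism_def by blast+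
  have surj: "surj \<sigma>" and inj: "inj \<sigma>" using bij\<sigma> by (simp_all add: bij_is_surj bij_is_inj)
  have \<sigma>0 [simp]: "\<sigma> 0 = 0" using \<sigma>_add[of 0 0] by (metis add_0_right add_left_cancel)
  have \<sigma>_eq_0 [simp]: "\<sigma> x = 0 \<longleftrightarrow> x = 0" for x using inj \<sigma>0 by (metis injD)
  have g0 [simp]: "g 0 = 0" using g_add[of 0 0] by simp
  have g_eq_0: "g v = 0 \<longleftrightarrow> v = 0" for v using bij g0 by (metis bij_is_inj injD)
  define e1 e2 :: "'a ^ 2" where "e1 = vector [1, 0]" and "e2 = vector [0, 1]"
  define a b c d where "a = vec_nth (g e1) 1" and "b = vec_nth (g e2) 1"
    and "c = vec_nth (g e1) 2" and "d = vec_nth (g e2) 2"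
  note defs = a_def b_def c_def d_def
  have decomp: "v = vec_nth v 1 *s e1 + vec_nth v 2 *s e2" for v :: "'a ^ 2"
    by (simp add: vec2_eq_iff e1_def e2_def vector_2)
  have gv: "g v = \<sigma> (vec_nth v 1) *s g e1 + \<sigma> (vec_nth v 2) *s g e2" for v
    by (subst decomp) (simp only: g_add g_scale)
  have gv1: "vec_nth (g v) 1 = a * \<sigma> (vec_nth v 1) + b * \<sigma> (vec_nth v 2)"
    and gv2: "vec_nth (g v) 2 = c * \<sigma> (vec_nth v 1) + d * \<sigma> (vec_nth v 2)" for v
    by (subst gv, simp add: defs)+
  have det: "a * d - b * c \<noteq> 0"
  proof
    assume det0: "a * d - b * c = 0"
    have ker: "X = 0 \<and> Y = 0" if "a * X + b * Y = 0" "c * X + d * Y = 0" for X Y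
    proof -
      obtain X' Y' where XY: "X = \<sigma> X'" "Y = \<sigma> Y'" using surj by (metis surjD)
      have "g (vector [X', Y']) = 0"
        using that by (simp add: vec2_eq_iff gv1 gv2 XY vector_2)
      then have "(vector [X', Y'] :: 'a ^ 2) = 0" using g_eq_0 by blast
      then have "X' = 0 \<and> Y' = 0" by (simp add: vec2_eq_iff vector_2)
      then show ?thesis by (simp add: XY)
    qed
    have "d = 0 \<and> - c = 0" by (rule ker) (use det0 in \<open>simp_all add: algebra_simps\<close>)
    moreover have "b = 0 \<and> - a = 0" by (rule ker) (use det0 in \<open>simp_all add: algebra_simps\<close>)
    ultimately show False using ker[of 1 1] by simp
  qed
  have points: "vec.span {v} \<in> linear_set_of f \<longleftrightarrow> vec.span {g v} \<in> linear_set_of h" for v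
  proof -
    have img': "linear_set_of h = (\<lambda>P. g ` P) ` linear_set_of f"
      unfolding img[symmetric] using linear_set_of_subset_PG1[of f]
      by (intro image_cong) (auto simp: restrict_def)
    have "inj (\<lambda>P. g ` P)"
      using bij by (metis bij_is_inj inj_image_eq_iff injI)
    then show ?thesis
      unfolding img' image_span_singleton_semilinear[OF surj g_scale, symmetric]
      by (simp add: inj_image_mem_iff)
  qed
  have "(\<exists>x. x \<noteq> 0 \<and> Y * x = X * f x) \<longleftrightarrow>
     (\<exists>x. x \<noteq> 0 \<and> (c * X + d * Y) * x = (a * X + b * Y) * h x)" if XY: "(X, Y) \<noteq> (0, 0)" for X Y
  proof -
    obtain X' Y' where \<sigma>XY: "X = \<sigma> X'" "Y = \<sigma> Y'" using surj by (metis surjD)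
    define v :: "'a ^ 2" where "v = vector [X', Y']"
    have v: "v \<noteq> 0" using XY by (auto simp: v_def vec2_eq_iff vector_2 \<sigma>XY)
    have "(\<exists>x. x \<noteq> 0 \<and> Y * x = X * f x) \<longleftrightarrow> (\<exists>x'. \<sigma> x' \<noteq> 0 \<and> Y * \<sigma> x' = X * f (\<sigma> x'))"
      using surj by (metis surjD)
    also have "\<dots> \<longleftrightarrow> (\<exists>x'. x' \<noteq> 0 \<and> Y' * x' = X' * f x')"
      by (simp add: \<sigma>XY comm[rule_format, OF \<sigma>] inj_eq[OF inj] flip: \<sigma>_mult)
    also have "\<dots> \<longleftrightarrow> vec.span {v} \<in> linear_set_of f"
      using span_in_linear_set_of_iff[OF v, of f] by (simp add: v_def vector_2)
    also have "\<dots> \<longleftrightarrow> vec.span {g v} \<in> linear_set_of h"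
      by (rule points)
    also have "\<dots> \<longleftrightarrow> (\<exists>x. x \<noteq> 0 \<and> (c * X + d * Y) * x = (a * X + b * Y) * h x)"
      using span_in_linear_set_of_iff[of "g v" h] v g_eq_0
      by (simp add: gv1 gv2) (simp add: v_def vector_2 \<sigma>XY)
    finally show ?thesis .
  qed
  then show ?thesis using det by blast
qed

section \<open>The multilinear form of a linear set\<close>

context frobenius
begin

text \<open>
  The \<open>q\<close>-polynomial \<open>Y x - X f x\<close>, whose nonzero roots witness that the point \<open>(X, Y)\<close> lies on the
  linear set of \<open>f\<close>, and below the rows of its Dickson matrix. These rows depend linearly on the
  pair of conjugates \<open>(X^(q^i), Y^(q^i))\<close>.
\<close>

definition slope_coeffs :: "(int \<Rightarrow> 'a) \<Rightarrow> 'a \<Rightarrow> 'a \<Rightarrow> int \<Rightarrow> 'a" where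
  "slope_coeffs f X Y j = (if int n dvd j then Y else 0) - X * f j"

definition slope_row :: "(int \<Rightarrow> 'a) \<Rightarrow> 'a \<Rightarrow> 'a \<Rightarrow> nat \<Rightarrow> nat \<Rightarrow> 'a" where
  "slope_row f X Y i j = (if i = j then fr (int i) Y else 0) - fr (int i) X * fr (int i) (f (int j - int i))"

lemma periodic_slope_coeffs: "periodic f \<Longrightarrow> periodic (slope_coeffs f X Y)"
  by (simp add: periodic_def slope_coeffs_def dvd_mod_iff)

lemma qpoly_slope_coeffs: "qpoly (slope_coeffs f X Y) x = Y * x - X * qpoly f x"
proof -
  have "qpoly (slope_coeffs f X Y) x =
      (\<Sum>j<n. (if j = 0 then Y * x else 0) - X * (f (int j) * fr (int j) x))"
    unfolding qpoly_def slope_coeffs_def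
    by (intro sum.cong) (auto simp: algebra_simps dest: dvd_imp_le)
  also have "\<dots> = Y * x - X * qpoly f x"
    using n_pos by (simp add: sum_subtractf qpoly_def sum_distrib_left)
  finally show ?thesis .
qed

lemma pencil_slope_row:
  "pencil n (slope_row f a c) (slope_row f b d) (\<lambda>_. 1) (\<lambda>i. fr (int i) y) =
     dickson (slope_coeffs f (a + b * y) (c + d * y))"
proof (rule eq_matI)
  fix i j assume "i < dim_row (dickson (slope_coeffs f (a + b * y) (c + d * y)))"
    "j < dim_col (dickson (slope_coeffs f (a + b * y) (c + d * y)))"
  then have ij: "i < n" "j < n" by (simp_all add: dickson_def)
  have "int n dvd int j - int i \<longleftrightarrow> i = j"
  proof
    assume "int n dvd int j - int i"
    then have "int j mod int n = int i mod int n" by (simp add: mod_eq_dvd_iff)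
    then show "i = j" using ij by simp
  qed simp
  then show "pencil n (slope_row f a c) (slope_row f b d) (\<lambda>_. 1) (\<lambda>i. fr (int i) y) $$ (i, j) =
     dickson (slope_coeffs f (a + b * y) (c + d * y)) $$ (i, j)"
    using ij
    by (simp add: pencil_def dickson_def slope_coeffs_def slope_row_def fr_add fr_diff fr_mult fr_uminus
        algebra_simps)
qed (simp_all add: pencil_def dickson_def)

text \<open>
  The Dickson determinants of both sides vanish at the same points and take values in the
  subfield of size \<open>q\<close>, so their powers with exponent \<open>q - 1\<close> are the same function with
  values \<open>0\<close> and \<open>1\<close>.
\<close>

lemma moebius_imp_pencils_proportional:
  assumes f: "periodic f" and h: "periodic h"
    and slopes: "\<And>y. (\<exists>x. x \<noteq> 0 \<and> y * x = qpoly f x) \<longleftrightarrow>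
       (\<exists>x. x \<noteq> 0 \<and> (c + d * y) * x = (a + b * y) * qpoly h x)"
  shows "\<exists>k. \<forall>x z. Determinant.det (pencil n (slope_row f 1 0) (slope_row f 0 1) x z) =
           k * Determinant.det (pencil n (slope_row h a c) (slope_row h b d) x z)"
proof (rule pencils_proportional)
  fix y
  let ?D = "Determinant.det (dickson (slope_coeffs f 1 y))"
  let ?D' = "Determinant.det (dickson (slope_coeffs h (a + b * y) (c + d * y)))"
  (* nonzero elements of the subfield of size q *)
  have one: "u ^ (q - 1) = 1" if "u ^ q = u" "u \<noteq> 0" for u :: 'a
  proof -
    have "u ^ (q - 1) * u = 1 * u"
      using that(1) q_gt_1 by (simp flip: power_Suc2)
    then show ?thesis using that(2) by simp
  qed
  have "?D = 0 \<longleftrightarrow> ?D' = 0"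
    using slopes[of y] f h
    by (simp add: det_dickson_eq_0_iff periodic_slope_coeffs qpoly_slope_coeffs)
  moreover have "?D ^ q = ?D" "?D' ^ q = ?D'"
    using f h by (simp_all add: det_dickson_power_q periodic_slope_coeffs)
  ultimately have "?D ^ (q - 1) = ?D' ^ (q - 1)"
    using one q_gt_1 by (cases "?D = 0") auto
  then show "Determinant.det (pencil n (slope_row f 1 0) (slope_row f 0 1) (\<lambda>_. 1) (\<lambda>i. fr (int i) y)) ^ (q - 1) =
      Determinant.det (pencil n (slope_row h a c) (slope_row h b d) (\<lambda>_. 1) (\<lambda>i. fr (int i) y)) ^ (q - 1)"
    by (simp add: pencil_slope_row)
qed

text \<open>
  If \<open>h\<close> has only the two terms \<open>u\<close> and \<open>w\<close>, the choice of parameters turns the rows \<open>u\<close> and \<open>w\<close>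
  into multiples of unit vectors and removes the diagonal entry of row \<open>0\<close>, which then lies in the
  span of these unit vectors. The other rows are arbitrary.
\<close>

lemma det_two_term_pencil_eq_0:
  assumes uw: "u < n" "w < n" "u \<noteq> w" "u \<noteq> 0" "w \<noteq> 0"
    and supp: "\<And>j. j < n \<Longrightarrow> j \<noteq> u \<Longrightarrow> j \<noteq> w \<Longrightarrow> h (int j) = 0"
    and ad: "a * d - b * c \<noteq> 0"
    and row0: "x 0 = d" "z 0 = - c"
    and rows: "\<And>i. i = u \<or> i = w \<Longrightarrow> x i = - fr (int i) b \<and> z i = fr (int i) a"
  shows "Determinant.det (pencil n (slope_row h a c) (slope_row h b d) x z) = 0"
proof -
  define D where "D = a * d - b * c"
  have D: "D \<noteq> 0" using ad by (simp add: D_def)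
  define N where "N = pencil n (slope_row h a c) (slope_row h b d) x z"
  have N: "N \<in> carrier_mat n n" by (simp add: N_def pencil_def)
  have N0: "N $$ (0, j) = - D * h (int j)" if "j < n" for j
    using that n_pos by (auto simp: N_def D_def pencil_def slope_row_def row0 algebra_simps)
  have Ni: "N $$ (i, j) = (if j = i then fr (int i) D else 0)" if "i = u \<or> i = w" "j < n" for i j
    using that rows[of i] uw
    by (auto simp: N_def D_def pencil_def slope_row_def fr_diff fr_mult algebra_simps)
  (* the coefficients of the linear relation between the rows 0, u and w *)
  define v where "v i = (if i = 0 then 1 else if i = u \<or> i = w then D * h (int i) / fr (int i) D else 0)" for i
  have "transpose_mat N *\<^sub>v vec n v = 0\<^sub>v n"
  proof (rule eq_vecI)
    fix j assume "j < dim_vec (0\<^sub>v n :: 'a Matrix.vec)"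
    then have j: "j < n" by simp
    have "vec_index (transpose_mat N *\<^sub>v vec n v) j = (\<Sum>i\<in>{..<n}. N $$ (i, j) * v i)"
      using N j by (auto simp: scalar_prod_def lessThan_atLeast0)
    also have "\<dots> = (\<Sum>i\<in>{0, u, w}. N $$ (i, j) * v i)"
      using uw by (intro sum.mono_neutral_right) (auto simp: v_def)
    also have "\<dots> = 0"
      using uw j D supp[of j] by (auto simp: N0 Ni v_def)
    finally show "vec_index (transpose_mat N *\<^sub>v vec n v) j = vec_index (0\<^sub>v n) j"
      using j by simp
  qed (use N in auto)
  moreover have "vec n v \<noteq> 0\<^sub>v n"
  proof
    assume "vec n v = 0\<^sub>v n"
    then have "vec_index (vec n v) 0 = vec_index (0\<^sub>v n) 0" by simp
    then show False using n_pos by (simp add: v_def)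
  qed
  ultimately have "Determinant.det (transpose_mat N) = 0"
    using N by (subst det_0_iff_vec_prod_zero[of _ n]) (auto intro!: exI[of _ "vec n v"])
  then show ?thesis using det_transpose[OF N] by (simp add: N_def)
qed

lemma det_slope_pencil_eq_0E:
  assumes "Determinant.det (pencil n (slope_row f 1 0) (slope_row f 0 1) x z) = 0"
  obtains v where "\<exists>j<n. v j \<noteq> 0"
    "\<And>i. i < n \<Longrightarrow> z i * v i = x i * (\<Sum>j<n. fr (int i) (f (int j - int i)) * v j)"
proof -
  let ?N = "pencil n (slope_row f 1 0) (slope_row f 0 1) x z"
  have "?N \<in> carrier_mat n n" by (simp add: pencil_def)
  then obtain v where v: "v \<in> carrier_vec n" "v \<noteq> 0\<^sub>v n" "?N *\<^sub>v v = 0\<^sub>v n"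
    using assms det_0_iff_vec_prod_zero[of ?N n] by blast
  show ?thesis
  proof (rule that[of "vec_index v"])
    show "\<exists>j<n. vec_index v j \<noteq> 0"
      using v(1,2) by (auto simp: Matrix.vec_eq_iff)
    fix i assume i: "i < n"
    have "0 = (\<Sum>j<n. (x i * slope_row f 1 0 i j + z i * slope_row f 0 1 i j) * vec_index v j)"
      using v(3) i unfolding pencil_def mult_mat_vec_0_iff[OF v(1)] by simp
    also have "\<dots> = (\<Sum>j<n. (if i = j then z i * vec_index v j else 0)
        - x i * (fr (int i) (f (int j - int i)) * vec_index v j))"
      by (intro sum.cong) (auto simp: slope_row_def algebra_simps)
    also have "\<dots> = z i * vec_index v i - x i * (\<Sum>j<n. fr (int i) (f (int j - int i)) * vec_index v j)"
      using i by (simp add: sum_subtractf sum_distrib_left)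
    finally show "z i * vec_index v i = x i * (\<Sum>j<n. fr (int i) (f (int j - int i)) * vec_index v j)"
      by simp
  qed
qed

end

section \<open>Polynomials with four odd terms in degree eight\<close>

lemma cramer2:
  fixes p r s t y w :: "'a::idom"
  assumes "p * y + r * w = 0" "s * y + t * w = 0" "p * t \<noteq> r * s"
  shows "y = 0 \<and> w = 0"
proof -
  have "(p * t - r * s) * y = t * (p * y + r * w) - r * (s * y + t * w)"
    by (simp add: algebra_simps)
  then have "(p * t - r * s) * y = 0"
    unfolding assms(1,2) by simp
  moreover have "(p * t - r * s) * w = p * (s * y + t * w) - s * (p * y + r * w)"
    by (simp add: algebra_simps)
  then have "(p * t - r * s) * w = 0"
    unfolding assms(1,2) by simp
  ultimately show ?thesis using assms(3) by simp
qed

definition odd_coeffs :: "'a::zero \<Rightarrow> 'a \<Rightarrow> 'a \<Rightarrow> 'a \<Rightarrow> int \<Rightarrow> 'a" where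
  "odd_coeffs f1 f3 f5 f7 j = (if j mod 8 = 1 then f1 else if j mod 8 = 3 then f3
     else if j mod 8 = 5 then f5 else if j mod 8 = 7 then f7 else 0)"

locale frobenius8 = frobenius q 8 ty for q :: nat and ty :: "'a::{field,finite} itself"
begin

lemma all_less_8: "(\<forall>i<8. P i) \<longleftrightarrow> P 0 \<and> P 1 \<and> P 2 \<and> P 3 \<and> P 4 \<and> P 5 \<and> P 6 \<and> P (7::nat)"
  by (simp add: numeral_eq_Suc All_less_Suc) blast

lemma sum_less_8: "(\<Sum>j<8. g j) = g 0 + g 1 + g 2 + g 3 + g 4 + g 5 + g 6 + (g (7::nat) :: 'b::comm_monoid_add)"
  by (simp add: eval_nat_numeral)

text \<open>
  The parameters of the rows \<open>0\<close>, \<open>u\<close>, \<open>8 - u\<close> are those for which the form of a two-term polynomial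
  vanishes. Here the form does not vanish when the other rows are chosen well: rows in a set \<open>J\<close>
  are negated rows of the Dickson matrix of \<open>f\<close>, the remaining ones are unit vectors. Which \<open>J\<close> works
  depends on the position of the two points \<open>(- b, a)\<close> and \<open>(d, - c)\<close>, which are distinct points of
  the projective line. Let \<open>a \<noteq> 0\<close>, so that the rows \<open>u\<close> and \<open>8 - u\<close> keep a diagonal
  entry. For \<open>d = 0\<close> row \<open>0\<close> is a multiple of a unit vector and \<open>J\<close> can be empty. For \<open>d \<noteq> 0\<close> the set \<open>J\<close>
  consists of one odd index outside \<open>{u, 8 - u}\<close>: its row forces the entry \<open>0\<close> of a kernel vector to
  vanish, after which row \<open>0\<close> forces the entry at that index to vanish. If \<open>a = 0\<close>, the rows
  \<open>u\<close> and \<open>8 - u\<close> are multiples of rows of \<open>f\<close>, and the rows \<open>2\<close> and \<open>6\<close> complete them to two blocks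
  of size two, both with determinant \<open>f1 * f7 - f3 * f5\<close> up to sign.
\<close>

lemma det_odd_pencil_neq_0:
  assumes nz: "f1 \<noteq> 0" "f3 \<noteq> 0" "f5 \<noteq> 0" "f7 \<noteq> 0" and minor: "f1 * f7 \<noteq> f3 * f5"
    and fixed: "\<And>i. fr i f1 = f1" "\<And>i. fr i f3 = f3" "\<And>i. fr i f5 = f5" "\<And>i. fr i f7 = f7"
    and u: "u = 1 \<or> u = 3" and ad: "a * d - b * c \<noteq> 0"
  shows "\<exists>x z. x 0 = d \<and> z 0 = - c \<and> (\<forall>i. i = u \<or> i = 8 - u \<longrightarrow>
        x i = - fr (int i) b \<and> z i = fr (int i) a)
     \<and> Determinant.det (pencil 8 (slope_row (odd_coeffs f1 f3 f5 f7) 1 0) (slope_row (odd_coeffs f1 f3 f5 f7) 0 1) x z) \<noteq> 0"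
proof -
  let ?f = "odd_coeffs f1 f3 f5 f7"
  define x where "x J i = (if i = 0 then d else if i = u \<or> i = 8 - u then - fr (int i) b else if i \<in> J then 1 else 0)"
    for J :: "nat set" and i :: nat
  define z where "z J i = (if i = 0 then - c else if i = u \<or> i = 8 - u then fr (int i) a else if i \<in> J then 0 else 1)"
    for J :: "nat set" and i :: nat
  let ?N = "\<lambda>J. pencil 8 (slope_row ?f 1 0) (slope_row ?f 0 1) (x J) (z J)"
  have eqs: "\<exists>v. (\<exists>j<8. v j \<noteq> 0) \<and> (\<forall>i<8. z J i * v i = x J i * (\<Sum>j<8. ?f (int j - int i) * v j))"
    if det: "Determinant.det (?N J) = 0" for J
  proof -
    have "fr i (?f j) = ?f j" for i j
      by (simp add: odd_coeffs_def fixed)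
    note fr_f = this
    from det have "\<exists>v. (\<exists>j<8. v j \<noteq> 0) \<and>
        (\<forall>i<8. z J i * v i = x J i * (\<Sum>j<8. fr (int i) (?f (int j - int i)) * v j))"
      by (rule det_slope_pencil_eq_0E) blast
    then show ?thesis unfolding fr_f .
  qed
  (* a vanishing determinant yields a kernel vector v J, which the equations force to be zero *)
  have "\<exists>J. Determinant.det (?N J) \<noteq> 0"
  proof (rule ccontr)
    assume "\<not> (\<exists>J. Determinant.det (?N J) \<noteq> 0)"
    then have "Determinant.det (?N J) = 0" for J by blast
    then have "\<forall>J. \<exists>v. (\<exists>j<8. v j \<noteq> 0) \<and> (\<forall>i<8. z J i * v i = x J i * (\<Sum>j<8. ?f (int j - int i) * v j))"
      by (intro allI eqs)
    from choice[OF this] obtain v where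
      vE: "\<forall>J. (\<exists>j<8. v J j \<noteq> 0) \<and> (\<forall>i<8. z J i * v J i = x J i * (\<Sum>j<8. ?f (int j - int i) * v J j))"
      by (rule exE)
    have v: "\<exists>j<8. v J j \<noteq> 0" for J
      using vE[rule_format, of J] by (rule conjunct1)
    have E: "z J i * v J i = x J i * (\<Sum>j<8. ?f (int j - int i) * v J j)" if "i < 8" for i J
      using vE[THEN spec, of J, THEN conjunct2] that by blast
    have nonzero: "v J 0 \<noteq> 0 \<or> v J 1 \<noteq> 0 \<or> v J 2 \<noteq> 0 \<or> v J 3 \<noteq> 0 \<or>
        v J 4 \<noteq> 0 \<or> v J 5 \<noteq> 0 \<or> v J 6 \<noteq> 0 \<or> v J 7 \<noteq> 0" for J
      using v[of J] all_less_8[of "\<lambda>j. v J j = 0"] by blast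
    have S: "(\<Sum>j<8. ?f (int j - int 0) * w j) = f1 * w 1 + f3 * w 3 + f5 * w 5 + f7 * w 7"
      "(\<Sum>j<8. ?f (int j - int 1) * w j) = f7 * w 0 + f1 * w 2 + f3 * w 4 + f5 * w 6"
      "(\<Sum>j<8. ?f (int j - int 2) * w j) = f7 * w 1 + f1 * w 3 + f3 * w 5 + f5 * w 7"
      "(\<Sum>j<8. ?f (int j - int 3) * w j) = f5 * w 0 + f7 * w 2 + f1 * w 4 + f3 * w 6"
      "(\<Sum>j<8. ?f (int j - int 5) * w j) = f3 * w 0 + f5 * w 2 + f7 * w 4 + f1 * w 6"
      "(\<Sum>j<8. ?f (int j - int 6) * w j) = f3 * w 1 + f5 * w 3 + f7 * w 5 + f1 * w 7"
      "(\<Sum>j<8. ?f (int j - int 7) * w j) = f1 * w 0 + f3 * w 2 + f5 * w 4 + f7 * w 6" for w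
      by (simp_all add: sum_less_8 odd_coeffs_def)
    have row0: "z J 0 * v J 0 = x J 0 * (f1 * v J 1 + f3 * v J 3 + f5 * v J 5 + f7 * v J 7)"
     and row1: "z J 1 * v J 1 = x J 1 * (f7 * v J 0 + f1 * v J 2 + f3 * v J 4 + f5 * v J 6)"
     and row2: "z J 2 * v J 2 = x J 2 * (f7 * v J 1 + f1 * v J 3 + f3 * v J 5 + f5 * v J 7)"
     and row3: "z J 3 * v J 3 = x J 3 * (f5 * v J 0 + f7 * v J 2 + f1 * v J 4 + f3 * v J 6)"
     and row5: "z J 5 * v J 5 = x J 5 * (f3 * v J 0 + f5 * v J 2 + f7 * v J 4 + f1 * v J 6)"
     and row6: "z J 6 * v J 6 = x J 6 * (f3 * v J 1 + f5 * v J 3 + f7 * v J 5 + f1 * v J 7)"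
     and row7: "z J 7 * v J 7 = x J 7 * (f1 * v J 0 + f3 * v J 2 + f5 * v J 4 + f7 * v J 6)" for J
      using E[of 0 J] E[of 1 J] E[of 2 J] E[of 3 J] E[of 5 J] E[of 6 J] E[of 7 J] unfolding S by simp_all
    have unit: "v J i = 0" if "i < 8" "i \<notin> J" "i \<notin> {0, u, 8 - u}" for i J
      using E[of i J] that by (simp add: x_def z_def)
    show False
    proof (cases "a = 0")
      case a: True
      then have bc: "b \<noteq> 0" "c \<noteq> 0" using ad by auto
      let ?v = "v {2, 6}"
      from u show False
      proof
        assume u: "u = 1"
        have v0: "?v 3 = 0" "?v 4 = 0" "?v 5 = 0"
          using unit[of 3 "{2, 6}"] unit[of 4 "{2, 6}"] unit[of 5 "{2, 6}"] u by simp_all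
        have "f7 * ?v 1 + f5 * ?v 7 = 0" "f3 * ?v 1 + f1 * ?v 7 = 0"
          using row2[of "{2, 6}"] row6[of "{2, 6}"] u v0 by (simp_all add: x_def z_def)
        then have v1: "?v 1 = 0 \<and> ?v 7 = 0"
          by (rule cramer2) (use minor in \<open>simp add: mult.commute\<close>)
        then have v2: "?v 0 = 0"
          using row0[of "{2, 6}"] v0 bc by (simp add: x_def z_def)
        have "f1 * ?v 2 + f5 * ?v 6 = 0" "f3 * ?v 2 + f7 * ?v 6 = 0"
          using row1[of "{2, 6}"] row7[of "{2, 6}"] u v0 v1 v2 a bc by (simp_all add: x_def z_def)
        then have "?v 2 = 0 \<and> ?v 6 = 0"
          by (rule cramer2) (use minor in \<open>simp add: mult.commute\<close>)
        then show False using nonzero[of "{2, 6}"] v0 v1 v2 by simp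
      next
        assume u: "u = 3"
        have v0: "?v 1 = 0" "?v 4 = 0" "?v 7 = 0"
          using unit[of 1 "{2, 6}"] unit[of 4 "{2, 6}"] unit[of 7 "{2, 6}"] u by simp_all
        have "f1 * ?v 3 + f3 * ?v 5 = 0" "f5 * ?v 3 + f7 * ?v 5 = 0"
          using row2[of "{2, 6}"] row6[of "{2, 6}"] u v0 by (simp_all add: x_def z_def)
        then have v1: "?v 3 = 0 \<and> ?v 5 = 0"
          by (rule cramer2) (use minor in \<open>simp add: mult.commute\<close>)
        then have v2: "?v 0 = 0"
          using row0[of "{2, 6}"] v0 bc by (simp add: x_def z_def)
        have "f7 * ?v 2 + f3 * ?v 6 = 0" "f5 * ?v 2 + f1 * ?v 6 = 0"
          using row3[of "{2, 6}"] row5[of "{2, 6}"] u v0 v1 v2 a bc by (simp_all add: x_def z_def)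
        then have "?v 2 = 0 \<and> ?v 6 = 0"
          by (rule cramer2) (use minor in \<open>simp add: mult.commute\<close>)
        then show False using nonzero[of "{2, 6}"] v0 v1 v2 by simp
      qed
    next
      case a: False
      show False
      proof (cases "d = 0")
        case d: True
        have c: "c \<noteq> 0" using ad d by auto
        then have v0: "v {} 0 = 0" using row0[of "{}"] d by (simp add: x_def z_def)
        have v1: "v {} 2 = 0" "v {} 4 = 0" "v {} 6 = 0"
          using unit[of 2 "{}"] unit[of 4 "{}"] unit[of 6 "{}"] u by auto
        from u show False
        proof
          assume u: "u = 1"
          have "v {} 3 = 0" "v {} 5 = 0" "v {} 1 = 0" "v {} 7 = 0"
            using unit[of 3 "{}"] unit[of 5 "{}"] row1[of "{}"] row7[of "{}"] u a v0 v1 by (simp_all add: x_def z_def)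
          then show False using nonzero[of "{}"] v0 v1 by simp
        next
          assume u: "u = 3"
          have "v {} 1 = 0" "v {} 7 = 0" "v {} 3 = 0" "v {} 5 = 0"
            using unit[of 1 "{}"] unit[of 7 "{}"] row3[of "{}"] row5[of "{}"] u a v0 v1 by (simp_all add: x_def z_def)
          then show False using nonzero[of "{}"] v0 v1 by simp
        qed
      next
        case d: False
        from u show False
        proof
          assume u: "u = 1"
          let ?v = "v {3}"
          have v0: "?v 2 = 0" "?v 4 = 0" "?v 5 = 0" "?v 6 = 0"
            using unit[of 2 "{3}"] unit[of 4 "{3}"] unit[of 5 "{3}"] unit[of 6 "{3}"] u by simp_all
          then have v1: "?v 0 = 0" using row3[of "{3}"] u nz by (simp add: x_def z_def)
          then have v2: "?v 1 = 0" "?v 7 = 0"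
            using row1[of "{3}"] row7[of "{3}"] u a v0 by (simp_all add: x_def z_def)
          then have "?v 3 = 0" using row0[of "{3}"] d nz v0 v1 by (simp add: x_def z_def)
          then show False using nonzero[of "{3}"] v0 v1 v2 by simp
        next
          assume u: "u = 3"
          let ?v = "v {1}"
          have v0: "?v 2 = 0" "?v 4 = 0" "?v 6 = 0" "?v 7 = 0"
            using unit[of 2 "{1}"] unit[of 4 "{1}"] unit[of 6 "{1}"] unit[of 7 "{1}"] u by simp_all
          then have v1: "?v 0 = 0" using row1[of "{1}"] u nz by (simp add: x_def z_def)
          then have v2: "?v 3 = 0" "?v 5 = 0"
            using row3[of "{1}"] row5[of "{1}"] u a v0 by (simp_all add: x_def z_def)
          then have "?v 1 = 0" using row0[of "{1}"] d nz v0 v1 by (simp add: x_def z_def)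
          then show False using nonzero[of "{1}"] v0 v1 v2 by simp
        qed
      qed
    qed
  qed
  then obtain J where J: "Determinant.det (?N J) \<noteq> 0" by (rule exE)
  have "x J 0 = d" "z J 0 = - c" "\<forall>i. i = u \<or> i = 8 - u \<longrightarrow> x J i = - fr (int i) b \<and> z J i = fr (int i) a"
    using u by (auto simp: x_def z_def)
  then show ?thesis
    using J by (intro exI[of _ "x J"] exI[of _ "z J"] conjI)
qed

lemma qpoly_odd_coeffs: "qpoly (odd_coeffs f1 f3 f5 f7) x = f1 * fr 1 x + f3 * fr 3 x + f5 * fr 5 x + f7 * fr 7 x"
  by (simp add: qpoly_def sum_less_8 odd_coeffs_def)

lemma psi8_eq_qpoly: "psi8 q = qpoly (odd_coeffs (1 / 2) (1 / 2) (- (1 / 2)) (1 / 2))"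
  using fr_of_nat[of 1] fr_of_nat[of 3] fr_of_nat[of 5] fr_of_nat[of 7]
  by (auto simp: psi8_def qpoly_odd_coeffs algebra_simps fun_eq_iff)

text \<open>
  In the group algebra of the cyclic group generated by the Frobenius map \<open>t\<close>, the square
  of \<open>t + t^3 - t^5 + t^7\<close> is \<open>4 t^2\<close>.
\<close>

lemma psi8_psi8:
  assumes "(2::'a) \<noteq> 0"
  shows "psi8 q (psi8 q x) = fr 2 x"
proof -
  define h :: 'a where "h = 1 / 2"
  have h: "h + h = 1" using assms by (simp add: h_def)
  have psi: "psi8 q y = h * (fr 1 y + fr 3 y - fr 5 y + fr 7 y)" for y
    by (simp add: psi8_eq_qpoly qpoly_odd_coeffs h_def algebra_simps)
  have fr_h: "fr i h = h" for i by (simp add: h_def fr_half)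
  have wrap: "fr 8 x = fr 0 x" "fr 10 x = fr 2 x" "fr 12 x = fr 4 x" "fr 14 x = fr 6 x"
    by (rule fr_cong, simp)+
  have "psi8 q (psi8 q x) = (h + h) * (h + h) * fr 2 x"
    by (simp add: psi fr_add fr_diff fr_mult fr_h fr_fr wrap algebra_simps)
  then show ?thesis by (simp add: h)
qed

lemma psi8_cubed:
  assumes "(2::'a) \<noteq> 0"
  shows "(psi8 q ^^ 3) = qpoly (odd_coeffs (1 / 2) (1 / 2) (1 / 2) (- (1 / 2)))"
proof
  fix x :: 'a
  define h :: 'a where "h = 1 / 2"
  have psi: "psi8 q y = h * (fr 1 y + fr 3 y - fr 5 y + fr 7 y)" for y
    by (simp add: psi8_eq_qpoly qpoly_odd_coeffs h_def algebra_simps)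
  have fr_h: "fr i h = h" for i by (simp add: h_def fr_half)
  have wrap: "fr 9 x = fr 1 x"
    by (rule fr_cong) simp
  have "(psi8 q ^^ 3) x = psi8 q (psi8 q (psi8 q x))"
    by (simp add: eval_nat_numeral)
  also have "\<dots> = fr 2 (psi8 q x)" 
    by (rule psi8_psi8[OF assms])
  also have "\<dots> = h * fr 1 x + h * fr 3 x + h * fr 5 x + (- h) * fr 7 x"
    by (simp add: psi fr_add fr_diff fr_mult fr_fr fr_h wrap algebra_simps)
  also have "\<dots> = qpoly (odd_coeffs (1 / 2) (1 / 2) (1 / 2) (- (1 / 2))) x"
    by (simp add: qpoly_odd_coeffs h_def)
  finally show "(psi8 q ^^ 3) x = qpoly (odd_coeffs (1 / 2) (1 / 2) (1 / 2) (- (1 / 2))) x" .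
qed

text \<open>
  Coefficients fixed by all automorphisms make \<open>f\<close> commute with the automorphism part of a
  semilinear map, and make its Dickson matrix circulant. The support \<open>{s, 8 - s}\<close> of a polynomial
  defining LP-type is symmetric, so it is described by its smaller index \<open>u\<close>, which is 1 or 3.
\<close>

lemma not_LP_type_odd_qpoly:
  assumes nz: "f1 \<noteq> 0" "f3 \<noteq> 0" "f5 \<noteq> 0" "f7 \<noteq> 0" and minor: "f1 * f7 \<noteq> f3 * f5"
    and fixed: "\<And>\<sigma> y. field_automorphism \<sigma> \<Longrightarrow> y \<in> {f1, f3, f5, f7} \<Longrightarrow> \<sigma> y = (y::'a)"
  shows "\<not> LP_type q 8 (linear_set_of (qpoly (odd_coeffs f1 f3 f5 f7)))"
proof
  let ?f = "odd_coeffs f1 f3 f5 f7"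
  assume "LP_type q 8 (linear_set_of (qpoly ?f))"
  then obtain s \<delta> where s: "1 \<le> s" "s \<le> 8 - 1" "coprime s 8"
    and equiv: "PGammaL_equivalent (linear_set_of (qpoly ?f))
      (linear_set_of (\<lambda>x::'a. \<delta> * x ^ (q ^ s) + x ^ (q ^ (8 - s))))"
    unfolding LP_type_def by blast
  define h :: "int \<Rightarrow> 'a" where
    "h j = (if j mod 8 = int s then \<delta> else if j mod 8 = int (8 - s) then 1 else 0)" for j
  have s_cases: "s = 1 \<or> s = 3 \<or> s = 5 \<or> s = 7"
  proof -
    have "odd s"
      using s(3) by (auto dest: coprime_common_divisor[of s 8 2])
    then show ?thesis using s(1,2) by presburger
  qed
  have h_eq: "(\<lambda>x::'a. \<delta> * x ^ (q ^ s) + x ^ (q ^ (8 - s))) = qpoly h"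
    using s_cases
    by (elim disjE)
       (simp_all add: fun_eq_iff qpoly_def sum_less_8 h_def fr_of_nat[symmetric]
          fr_of_nat[of 1, simplified, symmetric] add.commute)
  define u where "u = min s (8 - s)"
  have u: "u = 1 \<or> u = 3" and supp: "\<And>j. j < 8 \<Longrightarrow> j \<noteq> u \<Longrightarrow> j \<noteq> 8 - u \<Longrightarrow> h (int j) = 0"
    using s_cases by (auto simp: u_def h_def)
  have f: "periodic ?f" and h: "periodic h"
    by (simp_all add: periodic_def odd_coeffs_def h_def)
  have fr_fixed: "fr i y = y" if "y \<in> {f1, f3, f5, f7}" for i y
    using fixed[OF field_automorphism_fr that] .
  have comm: "\<forall>\<sigma> x. field_automorphism \<sigma> \<longrightarrow> qpoly ?f (\<sigma> x) = \<sigma> (qpoly ?f x)"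
  proof (intro allI impI)
    fix \<sigma> x assume \<sigma>: "field_automorphism (\<sigma> :: 'a \<Rightarrow> 'a)"
    show "qpoly ?f (\<sigma> x) = \<sigma> (qpoly ?f x)"
      using fixed[OF \<sigma>] field_automorphism_power[OF \<sigma>] \<sigma>
      by (simp add: qpoly_odd_coeffs field_automorphism_def fr_def)
  qed
  obtain a b c d where ad: "a * d - b * c \<noteq> 0"
    and slopes: "\<forall>X Y. (X, Y) \<noteq> (0, 0) \<longrightarrow> (\<exists>x. x \<noteq> 0 \<and> Y * x = X * qpoly ?f x) \<longleftrightarrow>
       (\<exists>x. x \<noteq> 0 \<and> (c * X + d * Y) * x = (a * X + b * Y) * qpoly h x)"
    using PGammaL_equivalent_imp_moebius[OF equiv[unfolded h_eq] comm] by (elim exE conjE)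
  have "(\<exists>x. x \<noteq> 0 \<and> y * x = qpoly ?f x) \<longleftrightarrow>
      (\<exists>x. x \<noteq> 0 \<and> (c + d * y) * x = (a + b * y) * qpoly h x)" for y
    using slopes[THEN spec, of 1, THEN spec, of y] by simp
  from moebius_imp_pencils_proportional[OF f h this]
  obtain k where k: "\<forall>x z. Determinant.det (pencil 8 (slope_row ?f 1 0) (slope_row ?f 0 1) x z) =
       k * Determinant.det (pencil 8 (slope_row h a c) (slope_row h b d) x z)"
    by (rule exE)
  have "\<exists>x z. x 0 = d \<and> z 0 = - c \<and> (\<forall>i. i = u \<or> i = 8 - u \<longrightarrow>
        x i = - fr (int i) b \<and> z i = fr (int i) a)
     \<and> Determinant.det (pencil 8 (slope_row ?f 1 0) (slope_row ?f 0 1) x z) \<noteq> 0"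
    by (rule det_odd_pencil_neq_0[OF nz minor _ _ _ _ u ad]; rule fr_fixed; simp)
  then obtain x z where xz: "x 0 = d" "z 0 = - c"
      "\<forall>i. i = u \<or> i = 8 - u \<longrightarrow> x i = - fr (int i) b \<and> z i = fr (int i) a"
    and neq: "Determinant.det (pencil 8 (slope_row ?f 1 0) (slope_row ?f 0 1) x z) \<noteq> 0"
    by (elim exE conjE)
  have "Determinant.det (pencil 8 (slope_row h a c) (slope_row h b d) x z) = 0"
  proof (rule det_two_term_pencil_eq_0[where u = u and w = "8 - u"])
    show "u < 8" "8 - u < 8" "u \<noteq> 8 - u" "u \<noteq> 0" "8 - u \<noteq> 0"
      using u by auto
    show "h (int j) = 0" if "j < 8" "j \<noteq> u" "j \<noteq> 8 - u" for j
      using that by (rule supp)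
    show "x i = - fr (int i) b \<and> z i = fr (int i) a" if "i = u \<or> i = 8 - u" for i
      using xz(3) that by blast
  qed (rule ad xz(1,2))+
  then show False using neq k[rule_format, of x z] by simp
qed

end

theorem proposition3p5:
  fixes q k :: nat
  assumes "primepow q" and "odd q"
    and "CARD('a::{field, finite}) = q ^ 8"
    and "k \<in> {1, 3}"
  shows "\<not> LP_type q 8 (linear_set_of (psi8 q ^^ k :: 'a \<Rightarrow> 'a))"
proof -
  interpret frobenius8 q "TYPE('a)"
    by unfold_locales (use assms in auto)
  let ?h = "1 / 2 :: 'a"
  have two: "(2::'a) \<noteq> 0"
  proof
    assume "(2::'a) = 0"
    then have "CHAR('a) dvd 2"
      using of_nat_eq_0_iff_char_dvd[where ?'a = 'a, of 2] by simp
    moreover obtain e where e: "q = CHAR('a) ^ e"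
      using q_power_CHAR by blast
    ultimately have "CHAR('a) = 2"
      using prime_CHAR primes_dvd_imp_eq two_is_prime_nat by blast
    then have "q = 2 ^ e" using e by simp
    then show False using \<open>odd q\<close> q_gt_1 by (cases e) auto
  qed
  then have nz: "?h \<noteq> 0" "- ?h \<noteq> 0" by simp_all
  have "y * y \<noteq> y * - y" "y * - y \<noteq> y * y" if "y \<noteq> 0" for y :: 'a
  proof -
    have "2 * (y * y) \<noteq> 0" using two that by simp
    then have "y * y + y * y \<noteq> 0" by (simp only: mult_2 not_False_eq_True)
    then show "y * y \<noteq> y * - y" by (simp only: mult_minus_right eq_neg_iff_add_eq_0 not_False_eq_True)
    then show "y * - y \<noteq> y * y" by (rule not_sym)
  qed
  then have minor: "?h * ?h \<noteq> ?h * - ?h" "?h * - ?h \<noteq> ?h * ?h"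
    using nz(1) by blast+
  have fixed: "\<sigma> y = y" if "field_automorphism \<sigma>" "y = ?h \<or> y = - ?h" for \<sigma> :: "'a \<Rightarrow> 'a" and y
    using that field_automorphism_half[OF that(1)] field_automorphism_uminus[OF that(1)]
    by (elim disjE) (simp_all only:)
  from assms(4) consider "k = 1" | "k = 3" by blast
  then show ?thesis
  proof cases
    case 1
    have "\<not> LP_type q 8 (linear_set_of (qpoly (odd_coeffs ?h ?h (- ?h) ?h)))"
      by (rule not_LP_type_odd_qpoly[OF nz(1) nz(1) nz(2) nz(1) minor(1)], erule fixed) blast
    then show ?thesis unfolding 1 psi8_eq_qpoly[symmetric] by simp
  next
    case 2
    have "\<not> LP_type q 8 (linear_set_of (qpoly (odd_coeffs ?h ?h ?h (- ?h))))"
      by (rule not_LP_type_odd_qpoly[OF nz(1) nz(1) nz(1) nz(2) minor(2)], erule fixed) blast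
    then show ?thesis unfolding 2 psi8_cubed[OF two] .
  qed
qed

end
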